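(* Let $m\ge2$ and $d\ge2m$, let $\mathcal{X}=\{0,1\}^d$, and let $\mathcal{H}$ be the set of all disjunctions over $d$ variables without negations having at least one and at most $m$ variables, so that $n=|\mathcal{H}|=\sum_{i=1}^m\binom{d}{i}$. If the problem $(\mathcal{H},\mathcal{X})$ is $k$-neighborly, then $k\ge\sqrt n$.
   Context: A disjunction without negations with variable set $A\subseteq\{1,\dots,d\}$ is the function $h_A:\{0,1\}^d\to\{0,1\}$, $h_A(x)=\bigvee_{i\in A}x_i$. The elements of $\mathcal{X}$ are called tests. For tests $x,x'$ let $\Delta(x,x')=\{h\in\mathcal{H}: h(x)=0 \wedge h(x')=1\}$. The problem is $k$-neighborly if the undirected graph on $\mathcal{X}$ with an edge $(x,x')$ whenever $|\Delta(x,x')\cup\Delta(x',x)|\le k$ is connected. *)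

theory Defs
  imports Complex_Main "HOL-Library.FuncSet" "Graph_Theory.Digraph_Component"
begin

text \<open>The values 0 and 1 are rendered as \<^const>\<open>False\<close> and \<^const>\<open>True\<close>. Both the
  points of the cube and the hypotheses on it are extensional functions, so that equality of
  hypotheses is equality as functions on the cube.\<close>

definition cube :: "nat \<Rightarrow> (nat \<Rightarrow> bool) set" where
  "cube d = {1..d} \<rightarrow>\<^sub>E (UNIV :: bool set)"

definition disjunction :: "nat \<Rightarrow> nat set \<Rightarrow> (nat \<Rightarrow> bool) \<Rightarrow> bool" where
  "disjunction d A = (\<lambda>x\<in>cube d. \<exists>i\<in>A. x i)"

definition disjunctions :: "nat \<Rightarrow> nat \<Rightarrow> ((nat \<Rightarrow> bool) \<Rightarrow> bool) set" where
  "disjunctions d m = {disjunction d A | A. A \<subseteq> {1..d} \<and> 1 \<le> card A \<and> card A \<le> m}"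

definition Delta :: "('x \<Rightarrow> bool) set \<Rightarrow> 'x \<Rightarrow> 'x \<Rightarrow> ('x \<Rightarrow> bool) set" where
  "Delta H x x' = {h \<in> H. \<not> h x \<and> h x'}"

text \<open>An undirected graph is a symmetric digraph. Loops are left out, which does not affect
  connectedness. The finiteness condition matters only for infinite hypothesis classes, where
  \<^const>\<open>card\<close> would otherwise be 0.\<close>

definition neighbor_graph :: "nat \<Rightarrow> ('x \<Rightarrow> bool) set \<Rightarrow> 'x set \<Rightarrow> 'x pair_pre_digraph" where
  "neighbor_graph k H X =
     \<lparr> pverts = X,
       parcs = {(x, x'). x \<in> X \<and> x' \<in> X \<and> x \<noteq> x' \<and>
                  finite (Delta H x x' \<union> Delta H x' x) \<and>
                  card (Delta H x x' \<union> Delta H x' x) \<le> k} \<rparr>"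

definition neighborly :: "nat \<Rightarrow> ('x \<Rightarrow> bool) set \<Rightarrow> 'x set \<Rightarrow> bool" where
  "neighborly k H X \<longleftrightarrow> connected (with_proj (neighbor_graph k H X))"

end

(* The test 0 is rejected by every disjunction. If x is another test and x_i = 1, then every
   disjunction containing the variable i distinguishes 0 from x, so every edge at 0 needs k at
   least K, the sum of binomial (d - 1, j) over j < m. Absorption,
   (j + 1) * binomial (d, j + 1) = d * binomial (d - 1, j), gives n <= d * K, and d <= K since
   m >= 2. Hence n <= K^2 <= k^2. *)
theory Submission
  imports Defs
begin

text \<open>The point whose only true coordinate is \<open>j\<close> satisfies the disjunction over
  \<open>C\<close> exactly when \<open>j\<close> lies in \<open>C\<close>, so the values on these
  points recover the variable set.\<close>

lemma inj_on_disjunction: "inj_on (disjunction d) (Pow {1..d})"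
proof (rule inj_onI)
  fix A B assume A: "A \<in> Pow {1..d}" and B: "B \<in> Pow {1..d}" and eq: "disjunction d A = disjunction d B"
  have *: "disjunction d C (\<lambda>i\<in>{1..d}. i = j) \<longleftrightarrow> j \<in> C"
    if "C \<in> Pow {1..d}" "j \<in> {1..d}" for C j
  proof -
    have "(\<lambda>i\<in>{1..d}. i = j) \<in> cube d"
      by (simp add: cube_def)
    then show ?thesis
      using that by (auto simp: disjunction_def)
  qed
  then have "j \<in> A \<longleftrightarrow> j \<in> B" if "j \<in> {1..d}" for j
    using A B eq that by metis
  then show "A = B"
    using A B by blast
qed

text \<open>The sizes range over an arbitrary finite \<open>J\<close> because two ranges occur
  below: \<open>{1..m}\<close> for the whole class, and \<open>{..<m}\<close> for the variables that
  accompany a fixed one.\<close>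

lemma card_subsets_card_in:
  assumes "finite S" and "finite J"
  shows "card {A. A \<subseteq> S \<and> card A \<in> J} = (\<Sum>j\<in>J. card S choose j)"
proof -
  have "{A. A \<subseteq> S \<and> card A \<in> J} = (\<Union>j\<in>J. {A. A \<subseteq> S \<and> card A = j})"
    by blast
  also have "card \<dots> = (\<Sum>j\<in>J. card {A. A \<subseteq> S \<and> card A = j})"
    using assms by (intro card_UN_disjoint) auto
  finally show ?thesis
    using assms(1) by (simp add: n_subsets)
qed

lemma disjunctions_eq_image:
  "disjunctions d m = disjunction d ` {A. A \<subseteq> {1..d} \<and> card A \<in> {1..m}}"
  by (auto simp: disjunctions_def)

lemma card_disjunctions: "card (disjunctions d m) = (\<Sum>i=1..m. d choose i)"
proof -
  have "inj_on (disjunction d) {A. A \<subseteq> {1..d} \<and> card A \<in> {1..m}}"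
    by (rule inj_on_subset[OF inj_on_disjunction]) auto
  then show ?thesis
    by (simp add: disjunctions_eq_image card_image card_subsets_card_in del: atLeastAtMost_iff)
qed

text \<open>Removing \<open>i\<close> from a disjunction that contains it leaves at most
  \<open>m - 1\<close> of the other \<open>d - 1\<close> variables, possibly none; hence the sum
  starts at \<open>j = 0\<close> and stops before \<open>m\<close>.\<close>

lemma card_Delta_origin_ge:
  assumes x: "x \<in> cube d" and i: "i \<in> {1..d}" "x i"
  shows "(\<Sum>j<m. (d - 1) choose j) \<le> card (Delta (disjunctions d m) (\<lambda>i\<in>{1..d}. False) x)"
    (is "_ \<le> card ?D")
proof -
  define S where "S = {1..d} - {i}"
  define \<B> where "\<B> = {B. B \<subseteq> S \<and> card B \<in> {..<m}}"
  have "finite S"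
    by (simp add: S_def)
  have inj: "inj_on (disjunction d \<circ> insert i) \<B>"
  proof (rule comp_inj_on)
    show "inj_on (insert i) \<B>"
      unfolding \<B>_def S_def by (rule inj_onI) blast
    show "inj_on (disjunction d) (insert i ` \<B>)"
      using i by (intro inj_on_subset[OF inj_on_disjunction]) (auto simp: \<B>_def S_def)
  qed
  have "(disjunction d \<circ> insert i) ` \<B> \<subseteq> ?D"
  proof
    fix h assume "h \<in> (disjunction d \<circ> insert i) ` \<B>"
    then obtain B where B: "B \<subseteq> S" "card B < m" and h: "h = disjunction d (insert i B)"
      by (auto simp: \<B>_def)
    have sub: "insert i B \<subseteq> {1..d}"
      using B i by (auto simp: S_def)
    have "card (insert i B) = Suc (card B)"
      using B \<open>finite S\<close> by (subst card_insert_disjoint) (auto simp: S_def dest: finite_subset)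
    then have "h \<in> disjunctions d m"
      unfolding h disjunctions_eq_image using sub B by auto
    moreover have "(\<lambda>i\<in>{1..d}. False) \<in> cube d"
      by (simp add: cube_def)
    ultimately show "h \<in> ?D"
      using x i sub by (auto simp: Delta_def h disjunction_def)
  qed
  moreover have "finite ?D"
    by (simp add: Delta_def disjunctions_eq_image)
  ultimately have "card \<B> \<le> card ?D"
    using card_image[OF inj] card_mono by metis
  moreover have "card \<B> = (\<Sum>j<m. (d - 1) choose j)"
    using i \<open>finite S\<close> by (simp add: \<B>_def card_subsets_card_in S_def del: lessThan_iff)
  ultimately show ?thesis
    by simp
qed

text \<open>Only the first edge of a path from \<open>u\<close> to \<open>v\<close> matters; the
  vertex \<open>v\<close> is there to force the path to leave \<open>u\<close>.\<close>

lemma neighborly_obtain_neighbor: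
  assumes "neighborly k H X" "u \<in> X" "v \<in> X" "u \<noteq> v"
  obtains w where "w \<in> X" "u \<noteq> w" "finite (Delta H u w \<union> Delta H w u)"
    "card (Delta H u w \<union> Delta H w u) \<le> k"
proof -
  let ?G = "mk_symmetric (with_proj (neighbor_graph k H X))"
  have "u \<rightarrow>\<^sup>*\<^bsub>with_proj ?G\<^esub> v"
    using assms
    by (auto simp: neighborly_def connected_def strongly_connected_def neighbor_graph_def)
  then have "(u, v) \<in> (parcs ?G)\<^sup>*"
    by (auto dest: reachable_rtranclI)
  then obtain w where "(u, w) \<in> parcs ?G"
    using \<open>u \<noteq> v\<close> by (blast elim: converse_rtranclE)
  \<comment> \<open>The symmetric closure may have reversed the arc, but the union of the two
    \<open>Delta\<close> sets is the same in both directions.\<close>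
  then have "w \<in> X \<and> u \<noteq> w \<and> finite (Delta H u w \<union> Delta H w u) \<and>
      card (Delta H u w \<union> Delta H w u) \<le> k"
    by (auto simp: parcs_mk_symmetric neighbor_graph_def Un_commute)
  then show ?thesis
    using that by blast
qed

lemma sum_binomial_le_square:
  assumes "m \<ge> 2" and "d \<ge> 1"
  shows "(\<Sum>i=1..m. d choose i) \<le> (\<Sum>j<m. (d - 1) choose j)\<^sup>2"
proof -
  have absorb: "d choose Suc j \<le> d * ((d - 1) choose j)" for j
  proof -
    \<comment> \<open>The factor \<open>Suc j\<close> is at least 1; inserting it produces the left
      side of the absorption identity.\<close>
    have "d choose Suc j \<le> Suc j * (d choose Suc j)"
      by simp
    also have "\<dots> = d * ((d - 1) choose j)"
      using times_binomial_minus1_eq[of "Suc j" d] by simp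
    finally show ?thesis .
  qed
  have "(\<Sum>i=1..m. d choose i) = (\<Sum>j<m. d choose Suc j)"
    by (simp add: sum.atLeast1_atMost_eq)
  also have "\<dots> \<le> d * (\<Sum>j<m. (d - 1) choose j)"
    unfolding sum_distrib_left by (intro sum_mono absorb)
  also have "\<dots> \<le> (\<Sum>j<m. (d - 1) choose j)\<^sup>2"
  proof -
    \<comment> \<open>The terms at 0 and 1 are 1 and \<open>d - 1\<close>. Both indices lie below
      \<open>m\<close> because \<open>m \<ge> 2\<close>.\<close>
    have "d = (\<Sum>j\<in>{0, 1}. (d - 1) choose j)"
      using assms by simp
    also have "\<dots> \<le> (\<Sum>j<m. (d - 1) choose j)"
      using assms by (intro sum_mono2) auto
    finally show ?thesis
      unfolding power2_eq_square by (rule mult_right_mono) simp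
  qed
  finally show ?thesis .
qed

theorem mainTheorem7:
  fixes m d :: nat
  assumes "m \<ge> 2" and "d \<ge> 2 * m"
  shows "card (disjunctions d m) = (\<Sum>i=1..m. d choose i) \<and>
    (\<forall>k::nat. neighborly k (disjunctions d m) (cube d) \<longrightarrow>
       real k \<ge> sqrt (real (card (disjunctions d m))))"
proof (intro conjI allI impI card_disjunctions)
  fix k assume nb: "neighborly k (disjunctions d m) (cube d)"
  let ?H = "disjunctions d m" and ?o = "\<lambda>i\<in>{1..d}. False"
  have d: "d \<ge> 1"
    using assms by simp
  have cube: "?o \<in> cube d" "(\<lambda>i\<in>{1..d}. True) \<in> cube d"
    by (simp_all add: cube_def)
  \<comment> \<open>Coordinate 1 exists since \<open>d \<ge> 1\<close>, and the two tests differ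
    there.\<close>
  have neq: "?o \<noteq> (\<lambda>i\<in>{1..d}. True)"
    using d by (auto dest!: fun_cong[where x = 1])
  obtain x where x: "x \<in> cube d" "?o \<noteq> x" "finite (Delta ?H ?o x \<union> Delta ?H x ?o)"
      "card (Delta ?H ?o x \<union> Delta ?H x ?o) \<le> k"
    using neighborly_obtain_neighbor[OF nb cube neq] .
  have "\<exists>i\<in>{1..d}. x i"
  proof (rule ccontr)
    assume "\<not> (\<exists>i\<in>{1..d}. x i)"
    \<comment> \<open>Points of the cube are extensional, so agreement on \<open>{1..d}\<close>
      already gives equality of functions.\<close>
    then have "?o = x"
      using cube(1) x(1) unfolding cube_def by (intro PiE_ext) auto
    with x(2) show False by contradiction
  qed
  then obtain i where i: "i \<in> {1..d}" "x i" by blast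
  have "(\<Sum>j<m. (d - 1) choose j) \<le> card (Delta ?H ?o x)"
    by (rule card_Delta_origin_ge[OF x(1) i])
  also have "\<dots> \<le> card (Delta ?H ?o x \<union> Delta ?H x ?o)"
    using x(3) by (intro card_mono) auto
  also have "\<dots> \<le> k" by (rule x(4))
  finally have "(\<Sum>j<m. (d - 1) choose j)\<^sup>2 \<le> k\<^sup>2"
    by (rule power_mono) simp
  then have "card ?H \<le> k\<^sup>2"
    using sum_binomial_le_square[OF assms(1) d] unfolding card_disjunctions by linarith
  then have "real (card ?H) \<le> (real k)\<^sup>2"
    by (metis of_nat_le_iff of_nat_power)
  then show "sqrt (real (card ?H)) \<le> real k"
    by (intro real_le_lsqrt) auto
qed

end
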